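(* For every integer $d\ge 1$, $\gamma_1^{\mathrm L}(Q_d)=2^{d-1}$.
   Context: All graphs are finite and simple; $N_G(u)$ is the open neighborhood of $u$ in $G$. A set $D\subseteq V(G)$ is a dominating set if every vertex of $V(G)\setminus D$ has a neighbor in $D$. A dominating set $D$ of $G$ is a $1$-limited dominating set if $|N_G(u)\setminus D|\le 1$ for every $u\in D$. The $1$-limited domination number $\gamma_1^{\mathrm L}(G)$ is the minimum cardinality of a $1$-limited dominating set of $G$. The hypercube $Q_d$ has vertex set $\{0,1\}^d$, two vertices being adjacent if and only if they differ in exactly one coordinate. *)

theory Defs
  imports "Graph_Theory.Pair_Digraph"
begin

text \<open>
  Finite simple graphs are the instances of the locale \<open>pair_graph\<close>: an undirected edge is
  represented by its two opposite arcs, and \<open>u \<rightarrow>\<^bsub>G\<^esub> v\<close> is adjacency.  The definitions below are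
  meant for such graphs; on an infinite neighbourhood \<open>card\<close> would return 0.
\<close>

definition open_nbhd :: "'a pair_pre_digraph \<Rightarrow> 'a \<Rightarrow> 'a set" where
  "open_nbhd G u = {v \<in> pverts G. u \<rightarrow>\<^bsub>with_proj G\<^esub> v}"

definition dominating_set :: "'a pair_pre_digraph \<Rightarrow> 'a set \<Rightarrow> bool" where
  "dominating_set G D \<longleftrightarrow>
     D \<subseteq> pverts G \<and> (\<forall>v \<in> pverts G - D. open_nbhd G v \<inter> D \<noteq> {})"

definition one_limited_dominating_set :: "'a pair_pre_digraph \<Rightarrow> 'a set \<Rightarrow> bool" where
  "one_limited_dominating_set G D \<longleftrightarrow>
     dominating_set G D \<and> (\<forall>u \<in> D. card (open_nbhd G u - D) \<le> 1)"

definition one_limited_domination_number :: "'a pair_pre_digraph \<Rightarrow> nat" where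
  "one_limited_domination_number G = Min {card D | D. one_limited_dominating_set G D}"

text \<open>The set over which the minimum is taken is finite and nonempty.\<close>

lemma one_limited_dominating_set_pverts:
  assumes "pair_graph G"
  shows "one_limited_dominating_set G (pverts G)"
proof -
  have "open_nbhd G u - pverts G = {}" for u
    by (auto simp: open_nbhd_def)
  then have "card (open_nbhd G u - pverts G) \<le> 1" for u
    by (simp only: card.empty)
  then show ?thesis
    by (simp add: one_limited_dominating_set_def dominating_set_def)
qed

lemma finite_one_limited_dominating_cards:
  assumes "pair_graph G"
  shows "finite {card D | D. one_limited_dominating_set G D}"
proof -
  interpret pair_graph G by fact
  have "{card D | D. one_limited_dominating_set G D} \<subseteq> card ` Pow (pverts G)"
    by (auto simp: one_limited_dominating_set_def dominating_set_def)
  then show ?thesis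
    by (rule finite_subset) simp
qed

text \<open>Vertices are 0/1 words of length \<open>d\<close>, with \<open>False\<close> and \<open>True\<close> for 0 and 1.\<close>

definition hypercube :: "nat \<Rightarrow> bool list pair_pre_digraph" where
  "hypercube d =
     \<lparr>pverts = {x. length x = d},
      parcs = {(x, y). length x = d \<and> length y = d \<and> (\<exists>!i. i < d \<and> x ! i \<noteq> y ! i)}\<rparr>"

lemma pair_graph_hypercube: "pair_graph (hypercube d)"
proof -
  have fin: "finite {x :: bool list. length x = d}"
    using finite_lists_length_eq[of "UNIV :: bool set" d] by simp
  have sub: "parcs (hypercube d) \<subseteq> pverts (hypercube d) \<times> pverts (hypercube d)"
    by (auto simp: hypercube_def)
  have V: "finite (pverts (hypercube d))"
    using fin by (simp add: hypercube_def)
  have E: "finite (parcs (hypercube d))"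
    by (rule finite_subset[OF sub]) (simp add: V)
  have S: "sym (parcs (hypercube d))"
  proof (rule symI)
    fix x y
    assume "(x, y) \<in> parcs (hypercube d)"
    moreover have "(x ! i \<noteq> y ! i) = (y ! i \<noteq> x ! i)" for i
      by blast
    ultimately show "(y, x) \<in> parcs (hypercube d)"
      by (simp add: hypercube_def)
  qed
  have L: "fst e \<noteq> snd e" if "e \<in> parcs (hypercube d)" for e
  proof -
    obtain x y where e: "e = (x, y)"
      by (cases e)
    have "\<exists>!i. i < d \<and> x ! i \<noteq> y ! i"
      using that unfolding e hypercube_def by simp
    then have "x \<noteq> y"
      by blast
    then show ?thesis
      by (simp add: e)
  qed
  show ?thesis
  proof
    show "fst e \<in> pverts (hypercube d)" if "e \<in> parcs (hypercube d)" for e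
      using sub that by (metis mem_Sigma_iff prod.collapse subsetD)
    show "snd e \<in> pverts (hypercube d)" if "e \<in> parcs (hypercube d)" for e
      using sub that by (metis mem_Sigma_iff prod.collapse subsetD)
    show "symmetric (with_proj (hypercube d))"
      using S by (simp add: symmetric_def)
  qed (fact V E L)+
qed

end

theory Submission
  imports Defs
begin

text \<open>
  Sending every vertex outside \<open>D\<close> to a neighbour in \<open>D\<close> is injective when \<open>D\<close> is 1-limited, so
  \<open>D\<close> contains at least half of the vertices.  In the hypercube, a facet attains this bound.
\<close>

lemma card_pverts_le_one_limited_dominating_set:
  assumes "pair_graph G" and D: "one_limited_dominating_set G D"
  shows "card (pverts G) \<le> 2 * card D"
proof -
  interpret pair_graph G by fact
  have sub: "D \<subseteq> pverts G"
    and dom: "\<And>v. v \<in> pverts G - D \<Longrightarrow> open_nbhd G v \<inter> D \<noteq> {}"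
    and lim: "\<And>u. u \<in> D \<Longrightarrow> card (open_nbhd G u - D) \<le> 1"
    using D by (auto simp: one_limited_dominating_set_def dominating_set_def)
  have fin: "finite D"
    using sub by (rule finite_subset) simp
  \<comment> \<open>A union bound stands in for the injection: domination puts each vertex outside
    \<open>D\<close> into some \<open>open_nbhd G u - D\<close> with \<open>u\<close> in
    \<open>D\<close>, and there are \<open>card D\<close> such sets of at most one element
    each.\<close>
  have "pverts G - D \<subseteq> (\<Union>u\<in>D. open_nbhd G u - D)"
  proof
    fix v assume v: "v \<in> pverts G - D"
    then obtain u where u: "u \<in> D" "v \<rightarrow>\<^bsub>with_proj G\<^esub> u"
      using dom by (auto simp: open_nbhd_def)
    \<comment> \<open>Domination yields the arc from \<open>v\<close> to \<open>u\<close>, but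
      membership in \<open>open_nbhd G u\<close> asks for the opposite one.\<close>
    then have "u \<rightarrow>\<^bsub>with_proj G\<^esub> v"
      using sym_arcs by (auto simp: symmetric_def elim: symE)
    then show "v \<in> (\<Union>u\<in>D. open_nbhd G u - D)"
      using u v by (auto simp: open_nbhd_def)
  qed
  then have "card (pverts G - D) \<le> card (\<Union>u\<in>D. open_nbhd G u - D)"
    using fin by (intro card_mono) (auto simp: open_nbhd_def)
  also have "\<dots> \<le> (\<Sum>u\<in>D. card (open_nbhd G u - D))"
    using fin by (rule card_UN_le)
  also have "\<dots> \<le> card D"
    using sum_mono[of D _ "\<lambda>_. 1::nat"] lim by fastforce
  finally show ?thesis
    using card_Diff_subset[OF fin sub] card_mono[OF _ sub] by simp
qed

lemma card_bool_lists_length: "card {x :: bool list. length x = n} = 2 ^ n"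
  using card_lists_length_eq[of "UNIV :: bool set" n] by simp

text \<open>Different heads already use up the single coordinate allowed to differ, so the tails
  must agree. Hence the edges between the two facets given by the first coordinate form a perfect
  matching.\<close>

lemma hypercube_arc_Cons_neq_iff:
  assumes "a \<noteq> b"
  shows "(a # x, b # y) \<in> parcs (hypercube (Suc n)) \<longleftrightarrow> length x = n \<and> x = y"
proof -
  have "(\<exists>!i. i < Suc n \<and> (a # x) ! i \<noteq> (b # y) ! i) \<longleftrightarrow> (\<forall>i<n. x ! i = y ! i)" (is "?L \<longleftrightarrow> ?R")
  proof
    assume ?L
    moreover have "0 < Suc n \<and> (a # x) ! 0 \<noteq> (b # y) ! 0"
      using assms by simp
    ultimately have "\<not> (Suc i < Suc n \<and> (a # x) ! Suc i \<noteq> (b # y) ! Suc i)" for i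
      by (metis nat.distinct(1))
    then show ?R
      by simp
  next
    assume eq: ?R
    show ?L
    proof (rule ex1I)
      show "0 < Suc n \<and> (a # x) ! 0 \<noteq> (b # y) ! 0"
        using assms by simp
      show "i = 0" if "i < Suc n \<and> (a # x) ! i \<noteq> (b # y) ! i" for i
        using that eq by (cases i) auto
    qed
  qed
  moreover have "length x = n \<Longrightarrow> length y = n \<Longrightarrow> (\<forall>i<n. x ! i = y ! i) \<longleftrightarrow> x = y"
    by (auto intro: nth_equalityI)
  ultimately show ?thesis
    by (auto simp only: hypercube_def pair_pre_digraph.simps mem_Collect_eq case_prod_conv
        length_Cons nat.inject)
qed

text \<open>The perfect matching gives both properties: \<open>True # x\<close> is dominated by its
  partner \<open>False # x\<close>, and conversely \<open>True # x\<close> is the only neighbour of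
  \<open>False # x\<close> outside the facet.\<close>

lemma one_limited_dominating_set_hypercube_facet:
  "one_limited_dominating_set (hypercube (Suc n)) (Cons False ` {x. length x = n})"
    (is "one_limited_dominating_set ?Q ?D")
proof -
  have verts: "pverts ?Q = {x. length x = Suc n}"
    by (simp add: hypercube_def)
  have "open_nbhd ?Q v \<inter> ?D \<noteq> {}" if v: "v \<in> pverts ?Q - ?D" for v
  proof -
    obtain x where x: "v = True # x" "length x = n"
      using v by (cases v) (auto simp: verts image_iff)
    then have "False # x \<in> open_nbhd ?Q v \<inter> ?D"
      by (simp add: open_nbhd_def verts hypercube_arc_Cons_neq_iff)
    then show ?thesis
      by blast
  qed
  moreover have "card (open_nbhd ?Q u - ?D) \<le> 1" if u: "u \<in> ?D" for u
  proof -
    obtain x where x: "u = False # x" "length x = n"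
      using u by blast
    have "open_nbhd ?Q u - ?D \<subseteq> {True # x}"
    proof
      fix v assume v: "v \<in> open_nbhd ?Q u - ?D"
      \<comment> \<open>A vertex has length \<open>Suc n\<close>, so it is nonempty, and lying
        outside the facet forces its head to be \<open>True\<close>.\<close>
      then obtain y where y: "v = True # y"
        by (cases v) (auto simp: open_nbhd_def verts image_iff)
      show "v \<in> {True # x}"
        using v by (auto simp: open_nbhd_def x y hypercube_arc_Cons_neq_iff)
    qed
    then have "card (open_nbhd ?Q u - ?D) \<le> card {True # x}"
      by (intro card_mono) auto
    then show ?thesis
      by simp
  qed
  ultimately show ?thesis
    by (auto simp: one_limited_dominating_set_def dominating_set_def verts)
qed

theorem proposition21:
  fixes d :: nat
  assumes "d \<ge> 1"
  shows "one_limited_domination_number (hypercube d) = 2 ^ (d - 1)"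
proof -
  \<comment> \<open>This splits off the coordinate that the facet fixes and turns the truncated
    \<open>d - 1\<close> into \<open>n\<close>.\<close>
  obtain n where d: "d = Suc n"
    using assms by (cases d) auto
  have facet: "card (Cons False ` {x. length x = n}) = 2 ^ n"
    by (simp add: card_image card_bool_lists_length)
  \<comment> \<open>The cube has \<open>2 * 2 ^ n\<close> vertices, so halving the general bound
    leaves \<open>2 ^ n\<close>.\<close>
  have "2 ^ n \<le> card D" if "one_limited_dominating_set (hypercube d) D" for D
    using card_pverts_le_one_limited_dominating_set[OF pair_graph_hypercube that]
    by (simp add: d hypercube_def card_bool_lists_length)
  then have "Min {card D | D. one_limited_dominating_set (hypercube d) D} = 2 ^ n"
    using one_limited_dominating_set_hypercube_facet[of n] facet
    by (intro Min_eqI finite_one_limited_dominating_cards[OF pair_graph_hypercube])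
      (auto simp: d intro: sym)
  then show ?thesis
    by (simp add: one_limited_domination_number_def d)
qed

end
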